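(* For each positive integer $n$, let $h(n)$ denote the smallest number of distinct lines in a $1$-$2$ metric space on $n$ points (the minimum over all such spaces). Then, as $n\to\infty$, \[ (1+o(1))\,\alpha\, n^{4/3}\;\le\; h(n)\;\le\;(1+o(1))\,\beta\, n^{4/3} \] with $\alpha=2^{-7/3}$ and $\beta=3\cdot 2^{-5/3}$.
   Context: A $1$-$2$ metric space is a metric space in which each nonzero distance equals $1$ or $2$. For points $a,b,c$ of a metric space $(X,d)$, write $[abc]$ if $a,b,c$ are three distinct points and $d(a,b)+d(b,c)=d(a,c)$. For any two distinct points $u,v\in X$, the line $\overline{uv}$ is the set $\{p:[puv]\}\cup\{u\}\cup\{p:[upv]\}\cup\{v\}\cup\{p:[uvp]\}$. The lines of $(X,d)$ are the sets $\overline{uv}$ with $u,v$ ranging over pairs of distinct points; distinct lines are counted as distinct subsets of $X$. *)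

theory Defs
  imports "HOL-Analysis.Analysis" "HOL-Library.Landau_Symbols"
begin

definition one_two_metric_space :: "'a set \<Rightarrow> ('a \<Rightarrow> 'a \<Rightarrow> real) \<Rightarrow> bool" where
  "one_two_metric_space X d \<longleftrightarrow>
     Metric_space X d \<and> (\<forall>x\<in>X. \<forall>y\<in>X. d x y \<noteq> 0 \<longrightarrow> d x y = 1 \<or> d x y = 2)"

definition metric_between :: "'a set \<Rightarrow> ('a \<Rightarrow> 'a \<Rightarrow> real) \<Rightarrow> 'a \<Rightarrow> 'a \<Rightarrow> 'a \<Rightarrow> bool" where
  "metric_between X d a b c \<longleftrightarrow>
     a \<in> X \<and> b \<in> X \<and> c \<in> X \<and> a \<noteq> b \<and> b \<noteq> c \<and> a \<noteq> c \<and> d a b + d b c = d a c"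

definition metric_line :: "'a set \<Rightarrow> ('a \<Rightarrow> 'a \<Rightarrow> real) \<Rightarrow> 'a \<Rightarrow> 'a \<Rightarrow> 'a set" where
  "metric_line X d u v =
     {p. metric_between X d p u v} \<union> {u} \<union> {p. metric_between X d u p v} \<union> {v} \<union> {p. metric_between X d u v p}"

definition metric_lines :: "'a set \<Rightarrow> ('a \<Rightarrow> 'a \<Rightarrow> real) \<Rightarrow> 'a set set" where
  "metric_lines X d = {metric_line X d u v | u v. u \<in> X \<and> v \<in> X \<and> u \<noteq> v}"

text \<open>Every finite metric space is isometric to one whose points are natural numbers, so point
  sets of type \<^typ>\<open>nat set\<close> suffice to define the minimum; the lemmas below show that the
  minimum is attained and that it bounds the number of lines for points of any type.\<close>

definition min_lines :: "nat \<Rightarrow> nat" where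
  "min_lines n = (LEAST k. \<exists>(X :: nat set) d.
     finite X \<and> card X = n \<and> one_two_metric_space X d \<and> card (metric_lines X d) = k)"

lemma min_lines_attained:
  "\<exists>(X :: nat set) d. finite X \<and> card X = n \<and> one_two_metric_space X d
     \<and> card (metric_lines X d) = min_lines n"
proof -
  let ?d = "\<lambda>x y :: nat. if x = y then 0 else 1 :: real"
  have "one_two_metric_space {..<n} ?d"
    unfolding one_two_metric_space_def by (auto intro!: Metric_space.intro split: if_splits)
  then have "\<exists>k (X :: nat set) d. finite X \<and> card X = n \<and> one_two_metric_space X d
      \<and> card (metric_lines X d) = k"
    by (metis card_lessThan finite_lessThan)
  then show ?thesis
    unfolding min_lines_def by (rule LeastI_ex)
qed

lemma min_lines_le:
  fixes X :: "'a set"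
  assumes fin: "finite X" and sp: "one_two_metric_space X d"
  shows "min_lines (card X) \<le> card (metric_lines X d)"
proof (cases "X = {}")
  case True
  have "min_lines 0 \<le> card (metric_lines ({} :: nat set) (\<lambda>x y. if x = y then 0 else 1))"
    unfolding min_lines_def
    by (rule Least_le, rule exI[of _ "{}"], rule exI[of _ "\<lambda>x y. if x = y then 0 else 1"])
       (auto simp: one_two_metric_space_def intro!: Metric_space.intro)
  then show ?thesis using True by (simp add: metric_lines_def)
next
  case False
  obtain g :: "nat \<Rightarrow> 'a" where g: "bij_betw g {..<card X} X"
    using ex_bij_betw_nat_finite[OF fin] by (auto simp: atLeast0LessThan)
  define N where "N = {..<card X}"
  define e where "e = (\<lambda>i j. d (g i) (g j))"
  have inj: "inj_on g N" and im: "g ` N = X" and gX: "\<And>i. i \<in> N \<Longrightarrow> g i \<in> X"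
    using g by (auto simp: bij_betw_def N_def)
  have eqg: "g i = g j \<longleftrightarrow> i = j" if "i \<in> N" "j \<in> N" for i j
    using inj that by (auto dest: inj_onD)
  interpret Metric_space X d
    using sp by (simp add: one_two_metric_space_def)
  have "Metric_space N e"
    by (rule Metric_space.intro)
       (auto simp: e_def commute gX eqg intro!: triangle)
  then have spN: "one_two_metric_space N e"
    using sp gX by (auto simp: one_two_metric_space_def e_def)
  have btw: "metric_between N e i j k \<longleftrightarrow> metric_between X d (g i) (g j) (g k)"
    if "i \<in> N" "j \<in> N" "k \<in> N" for i j k
    using that by (auto simp: metric_between_def e_def gX eqg)
  have line: "g ` metric_line N e i j = metric_line X d (g i) (g j)" if ij: "i \<in> N" "j \<in> N" for i j
  proof -
    have sub: "metric_line N e i j \<subseteq> N" "metric_line X d (g i) (g j) \<subseteq> X"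
      using ij gX by (auto simp: metric_line_def metric_between_def)
    have mem: "g k \<in> metric_line X d (g i) (g j) \<longleftrightarrow> k \<in> metric_line N e i j" if "k \<in> N" for k
      using ij that by (auto simp: metric_line_def btw eqg)
    show ?thesis
    proof (intro subset_antisym subsetI)
      fix x assume "x \<in> g ` metric_line N e i j"
      then obtain k where "k \<in> metric_line N e i j" "x = g k" by blast
      then show "x \<in> metric_line X d (g i) (g j)" using mem sub(1) by blast
    next
      fix x assume x: "x \<in> metric_line X d (g i) (g j)"
      then have "x \<in> g ` N" using sub(2) im by blast
      then obtain k where "k \<in> N" "x = g k" by blast
      then show "x \<in> g ` metric_line N e i j" using mem x by blast
    qed
  qed
  have "(`) g ` metric_lines N e = metric_lines X d"
  proof (intro set_eqI iffI)
    fix L assume "L \<in> (`) g ` metric_lines N e"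
    then obtain i j where "i \<in> N" "j \<in> N" "i \<noteq> j" "L = g ` metric_line N e i j"
      by (auto simp: metric_lines_def)
    then show "L \<in> metric_lines X d"
      unfolding metric_lines_def using line gX eqg by blast
  next
    fix L assume "L \<in> metric_lines X d"
    then obtain u v where uv: "u \<in> X" "v \<in> X" "u \<noteq> v" "L = metric_line X d u v"
      by (auto simp: metric_lines_def)
    then obtain i j where ij: "i \<in> N" "j \<in> N" "u = g i" "v = g j"
      using im by blast
    then have "L = g ` metric_line N e i j" "metric_line N e i j \<in> metric_lines N e"
      using uv line by (auto simp: metric_lines_def)
    then show "L \<in> (`) g ` metric_lines N e" by blast
  qed
  moreover have "inj_on ((`) g) (metric_lines N e)"
  proof (rule inj_on_subset[OF inj_on_image_Pow[OF inj]])
    show "metric_lines N e \<subseteq> Pow N"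
      by (auto simp: metric_lines_def metric_line_def metric_between_def)
  qed
  ultimately have "card (metric_lines N e) = card (metric_lines X d)"
    by (metis card_image)
  then show ?thesis
    unfolding min_lines_def using spN
    by (intro Least_le exI[of _ N] exI[of _ e]) (auto simp: N_def)
qed

end

theory Submission
  imports Defs "HOL-Real_Asymp.Real_Asymp"
begin

text \<open>Let \<open>l\<close> be the number of lines, call two points far if their distance is 2, and call two far
  points twins if they have the same distance to every other point. At least half of the points are
  twinless or at least half of them have a twin. Two pairs of twinless points that generate the same
  line are disjoint, and \<open>k\<close> pairs generating one line force about \<open>k\<^sup>2/2\<close> lines, so a line
  is generated by at most \<open>\<surd>(2l) + 3\<close> of the \<open>n\<^sup>2/8\<close> pairs. If instead at least \<open>n/2\<close> points have a
  twin, then the far pairs among them generate essentially different lines, so the graph of far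
  pairs is sparse; by Turan's theorem it has an independent set of about \<open>n\<^sup>2/(8l)\<close> points, whose
  pairs all generate different lines. Both cases give \<open>l \<ge> 2\<^bsup>-7/3\<^esup> n\<^bsup>4/3\<^esup>\<close> asymptotically.\<close>

section \<open>Transversals, binomial estimates and Turan's bound\<close>

text \<open>Disjointness makes any choice function injective. It serves to pick one point from each
  of many pairs generating the same line.\<close>

lemma disjoint_family_transversal:
  assumes meets: "\<And>e. e \<in> F \<Longrightarrow> e \<inter> T \<noteq> {}"
    and disj: "\<And>e e'. \<lbrakk>e \<in> F; e' \<in> F; e \<noteq> e'\<rbrakk> \<Longrightarrow> e \<inter> e' = {}"
  obtains f where "\<And>e. e \<in> F \<Longrightarrow> f e \<in> e \<inter> T" "inj_on f F"
proof -
  have "\<forall>e\<in>F. \<exists>x. x \<in> e \<inter> T"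
    using meets by blast
  then obtain f where f: "\<And>e. e \<in> F \<Longrightarrow> f e \<in> e \<inter> T"
    by metis
  moreover have "inj_on f F"
    using f disj by (fastforce intro!: inj_onI)
  ultimately show thesis
    using that by blast
qed

lemma real_choose_two: "real (k choose 2) = real k * (real k - 1) / 2"
  by (cases k) (simp_all add: choose_two real_of_nat_div algebra_simps)

text \<open>Since (k-1)^2 \<le> k(k-1) \<le> 2m for k \<ge> 1. This turns each bound of a binomial
  coefficient by the number of lines into a bound on the size of a set.\<close>

lemma choose_two_le_imp:
  assumes "k choose 2 \<le> m"
  shows "real k \<le> 1 + sqrt (2 * real m)"
proof (cases "k \<le> 1")
  case True
  then show ?thesis by (simp add: add_increasing2)
next
  case False
  have "real k * (real k - 1) / 2 \<le> real m"
    using assms real_choose_two[of k] by (metis of_nat_le_iff)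
  moreover have "(real k - 1) * (real k - 1) \<le> real k * (real k - 1)"
    using False by (intro mult_right_mono) auto
  ultimately have "(real k - 1)\<^sup>2 \<le> 2 * real m"
    by (simp add: power2_eq_square)
  then have "real k - 1 \<le> sqrt (2 * real m)"
    by (rule real_le_rsqrt)
  then show ?thesis by simp
qed

text \<open>Turan's bound, by removing a maximal independent set: every other vertex sends at least
  one edge into it.\<close>

lemma independent_set_bound:
  fixes q :: real
  assumes "finite Z"
    and sym: "\<And>x y. r x y \<Longrightarrow> r y x"
    and "\<And>A. \<lbrakk>A \<subseteq> Z; \<And>x y. \<lbrakk>x \<in> A; y \<in> A\<rbrakk> \<Longrightarrow> \<not> r x y\<rbrakk> \<Longrightarrow> real (card A) \<le> q"
    and irrefl: "\<And>x. \<not> r x x"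
  shows "(real (card Z))\<^sup>2 \<le> q * (real (card Z) + real (card {(x, y) \<in> Z \<times> Z. r x y}))"
  using assms(1,3)
proof (induction "card Z" arbitrary: Z rule: less_induct)
  case less
  note fin = less.prems(1)
  show ?case
  proof (cases "Z = {}")
    case True
    then show ?thesis by simp
  next
    case False
    define I where "I = {A. A \<subseteq> Z \<and> (\<forall>x\<in>A. \<forall>y\<in>A. \<not> r x y)}"
    have finI: "finite I" using fin by (simp add: I_def)
    have "{} \<in> I" by (simp add: I_def)
    then obtain A where A: "A \<in> I" and max: "\<And>B. B \<in> I \<Longrightarrow> A \<subseteq> B \<Longrightarrow> A = B"
      using finite_has_maximal[OF finI] by (metis empty_iff)
    have AZ: "A \<subseteq> Z" and indep: "\<And>x y. x \<in> A \<Longrightarrow> y \<in> A \<Longrightarrow> \<not> r x y"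
      using A by (auto simp: I_def)
    have nbr: "\<exists>x\<in>A. r v x" if v: "v \<in> Z - A" for v
    proof (rule ccontr)
      assume "\<not> (\<exists>x\<in>A. r v x)"
      then have "insert v A \<in> I"
        using v AZ indep sym irrefl by (auto simp: I_def)
      then show False using max[of "insert v A"] v by blast
    qed
    then obtain g where g: "\<And>v. v \<in> Z - A \<Longrightarrow> g v \<in> A \<and> r v (g v)"
      by metis
    have "A \<noteq> {}" using nbr False by blast
    define W where "W = Z - A"
    define s where "s = real (card A)"
    define w where "w = real (card W)"
    have finA: "finite A" and finW: "finite W"
      using fin AZ by (auto simp: W_def finite_subset)
    have s0: "0 < s" using \<open>A \<noteq> {}\<close> finA by (simp add: s_def card_gt_0_iff)
    have sq: "s \<le> q" unfolding s_def using less.prems(2)[OF AZ] indep by blast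
    have z: "real (card Z) = w + s"
      using card_Diff_subset[OF finA AZ] card_mono[OF fin AZ] by (simp add: w_def s_def W_def)
    have less_card: "card W < card Z"
      using z s0 by (simp add: w_def)
    define E where "E = (\<lambda>V. {(x, y) \<in> V \<times> V. r x y})"
    have IH: "w\<^sup>2 \<le> q * (w + real (card (E W)))"
      unfolding w_def E_def
    proof (rule less.hyps[OF less_card finW])
      fix B assume "B \<subseteq> W" "\<And>x y. \<lbrakk>x \<in> B; y \<in> B\<rbrakk> \<Longrightarrow> \<not> r x y"
      then show "real (card B) \<le> q"
        by (intro less.prems(2)) (auto simp: W_def)
    qed
    \<comment> \<open>Each \<open>v\<close> outside \<open>A\<close> adds the ordered pairs
      \<open>(v, g v)\<close> and \<open>(g v, v)\<close>, which touch \<open>A\<close> and thus lie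
      outside \<open>E W\<close>; they are \<open>2 * w\<close> new pairs in total.\<close>
    have "E W \<union> (\<lambda>v. (v, g v)) ` W \<union> (\<lambda>v. (g v, v)) ` W \<subseteq> E Z"
      using g AZ sym by (auto simp: E_def W_def)
    moreover have finE: "finite (E Z)"
      unfolding E_def by (rule finite_subset[of _ "Z \<times> Z"]) (use fin in auto)
    ultimately have "card (E W \<union> (\<lambda>v. (v, g v)) ` W \<union> (\<lambda>v. (g v, v)) ` W) \<le> card (E Z)"
      using card_mono by blast
    moreover have "card (E W \<union> (\<lambda>v. (v, g v)) ` W \<union> (\<lambda>v. (g v, v)) ` W)
        = card (E W) + card W + card W"
    proof -
      have fE: "finite (E W)"
        unfolding E_def by (rule finite_subset[of _ "W \<times> W"]) (use finW in auto)
      have "card ((\<lambda>v. (v, g v)) ` W) = card W" "card ((\<lambda>v. (g v, v)) ` W) = card W"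
        by (auto intro!: card_image inj_onI)
      moreover have "E W \<inter> (\<lambda>v. (v, g v)) ` W = {}"
        "(E W \<union> (\<lambda>v. (v, g v)) ` W) \<inter> (\<lambda>v. (g v, v)) ` W = {}"
        using g by (auto simp: E_def W_def)
      ultimately show ?thesis
        using fE finW by (simp add: card_Un_disjoint)
    qed
    ultimately have "card (E W) + card W + card W \<le> card (E Z)" by simp
    then have EZ: "real (card (E W)) + 2 * w \<le> real (card (E Z))"
      by (simp add: w_def)
    have w0: "0 \<le> w" by (simp add: w_def)
    \<comment> \<open>The induction hypothesis handles \<open>w\<^sup>2\<close>, and
      \<open>s \<le> q\<close> the rest; the term \<open>2 * w\<close> is then paid for by the new
      pairs.\<close>
    have "(w + s)\<^sup>2 = w\<^sup>2 + s * (2 * w + s)"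
      by (simp add: power2_eq_square algebra_simps)
    also have "\<dots> \<le> q * (w + real (card (E W))) + q * (2 * w + s)"
      using IH sq s0 w0 by (intro add_mono mult_right_mono) auto
    also have "\<dots> \<le> q * (w + s + real (card (E Z)))"
      using EZ sq s0 mult_left_mono[of "real (card (E W)) + 2 * w" "real (card (E Z))" q]
      by (simp add: algebra_simps)
    finally show ?thesis
      unfolding z E_def by simp
  qed
qed

section \<open>Lines in a finite 1-2 metric space\<close>

locale finite_one_two_space =
  fixes X :: "'a set" and d :: "'a \<Rightarrow> 'a \<Rightarrow> real"
  assumes finite_points: "finite X"
    and one_two: "one_two_metric_space X d"
begin

sublocale Metric_space X d
  using one_two by (simp add: one_two_metric_space_def)

abbreviation line :: "'a \<Rightarrow> 'a \<Rightarrow> 'a set" where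
  "line \<equiv> metric_line X d"

abbreviation lines :: "'a set set" where
  "lines \<equiv> metric_lines X d"

definition far :: "'a \<Rightarrow> 'a \<Rightarrow> bool" where
  "far u v \<longleftrightarrow> u \<in> X \<and> v \<in> X \<and> d u v = 2"

text \<open>Letting \<open>p\<close> range over the whole type amounts to letting it range over
  \<open>X\<close>, because \<open>far\<close> is false outside \<open>X\<close>.\<close>

definition twin :: "'a \<Rightarrow> 'a \<Rightarrow> bool" where
  "twin u v \<longleftrightarrow> far u v \<and> (\<forall>p. p \<noteq> u \<longrightarrow> p \<noteq> v \<longrightarrow> far p u = far p v)"

lemma far_sym: "far u v \<Longrightarrow> far v u"
  by (simp add: far_def commute)

lemma far_irrefl [simp]: "\<not> far u u"
  by (auto simp: far_def)

lemma far_in: "far u v \<Longrightarrow> u \<in> X \<and> v \<in> X"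
  by (simp add: far_def)

lemma near_dist: "\<lbrakk>u \<in> X; v \<in> X; u \<noteq> v; \<not> far u v\<rbrakk> \<Longrightarrow> d u v = 1"
  using one_two by (auto simp: far_def one_two_metric_space_def)

lemma between_sym: "metric_between X d a b c \<Longrightarrow> metric_between X d c b a"
  by (simp add: metric_between_def commute[of c] commute[of b a] eq_commute[of c] eq_commute[of b a])

lemma line_commute: "line u v = line v u"
  unfolding metric_line_def using between_sym by blast

text \<open>When \<open>d u v = 1\<close>, a third point is collinear with \<open>u\<close> and
  \<open>v\<close> iff its distances to them are 1 and 2 in some order. Treating an endpoint as far
  from itself makes the same formula cover \<open>u\<close> and \<open>v\<close>.\<close>

lemma in_line_near:
  assumes "u \<in> X" "v \<in> X" "u \<noteq> v" "\<not> far u v"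
  shows "p \<in> line u v \<longleftrightarrow> p \<in> X \<and> (p = u \<or> far p u) \<noteq> (p = v \<or> far p v)"
proof (cases "p \<in> X \<and> p \<noteq> u \<and> p \<noteq> v")
  case True
  then have "d p u = (if far p u then 2 else 1)" "d p v = (if far p v then 2 else 1)" "d u v = 1"
    using assms near_dist by (auto simp: far_def)
  then show ?thesis
    using assms True by (auto simp: metric_line_def metric_between_def commute)
next
  case False
  then show ?thesis
    using assms far_sym by (auto simp: metric_line_def metric_between_def)
qed

text \<open>A third point can only lie between \<open>u\<close> and \<open>v\<close>: outside the
  segment, a distance of at least 3 would be needed.\<close>

lemma in_line_far:
  assumes "far u v"
  shows "p \<in> line u v \<longleftrightarrow> p \<in> X \<and> (p = u \<or> p = v \<or> \<not> far p u \<and> \<not> far p v)"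
proof (cases "p \<in> X \<and> p \<noteq> u \<and> p \<noteq> v")
  case True
  then have "d p u = (if far p u then 2 else 1)" "d p v = (if far p v then 2 else 1)" "d u v = 2"
    using assms near_dist by (auto simp: far_def)
  moreover have "u \<in> X" "v \<in> X" "u \<noteq> v" using assms far_in by auto
  ultimately show ?thesis
    using True by (auto simp: metric_line_def metric_between_def commute)
next
  case False
  then show ?thesis
    using assms far_in by (auto simp: metric_line_def metric_between_def)
qed

lemma line_in_lines: "\<lbrakk>u \<in> X; v \<in> X; u \<noteq> v\<rbrakk> \<Longrightarrow> line u v \<in> lines"
  by (auto simp: metric_lines_def)

lemma far_line_in_lines: "far u v \<Longrightarrow> line u v \<in> lines"
  using line_in_lines[of u v] far_in[of u v] by (cases "u = v") auto

lemma finite_lines: "finite lines"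
proof (rule finite_subset)
  show "lines \<subseteq> Pow X"
    by (auto simp: metric_lines_def metric_line_def metric_between_def)
qed (simp add: finite_points)

text \<open>The point \<open>w\<close> lies on its own line and is far from \<open>u\<close>, but
  the only point of \<open>line u v\<close> far from \<open>u\<close> is \<open>v\<close>.\<close>

lemma far_lines_through_point:
  "\<lbrakk>far u v; far u w; line u v = line u w\<rbrakk> \<Longrightarrow> v = w"
  using in_line_far[of u v w] in_line_far[of u w w] far_sym[of u w] far_in[of u w] by auto

text \<open>By \<open>in_line_near\<close>, the line and the common point \<open>u\<close> determine
  which \<open>p\<close> are equal to or far from the other endpoint, so \<open>v\<close> and
  \<open>w\<close> agree on every \<open>p\<close>.\<close>

lemma near_lines_through_point:
  assumes "u \<in> X" "v \<in> X" "w \<in> X" "u \<noteq> v" "u \<noteq> w" "\<not> far u v" "\<not> far u w"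
    and eq: "line u v = line u w" and "v \<noteq> w"
  shows "twin v w"
proof -
  have iff: "(p = v \<or> far p v) = (p = w \<or> far p w)" if "p \<in> X" for p
    using in_line_near[of u v p] in_line_near[of u w p] assms that by blast
  then have "far v w" using assms by blast
  then show ?thesis using iff far_in unfolding twin_def by blast
qed

text \<open>The map \<open>\<phi>\<close> recovers a pair of members of \<open>F\<close> from a
  line, so different pairs need different lines.\<close>

lemma pairs_le_lines:
  assumes "finite F"
    and "\<And>e e'. \<lbrakk>e \<in> F; e' \<in> F; e \<noteq> e'\<rbrakk> \<Longrightarrow> \<exists>L\<in>lines. \<phi> L = {e, e'}"
  shows "card F choose 2 \<le> card lines"
proof -
  have "{B. B \<subseteq> F \<and> card B = 2} \<subseteq> \<phi> ` lines"
    using assms(2) by (fastforce simp: card_2_iff)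
  then have "card {B. B \<subseteq> F \<and> card B = 2} \<le> card (\<phi> ` lines)"
    by (intro card_mono) (simp_all add: finite_lines)
  also have "\<dots> \<le> card lines"
    by (rule card_image_le[OF finite_lines])
  finally show ?thesis
    by (simp add: n_subsets[OF assms(1)])
qed

text \<open>A point at distance 1 from both \<open>u\<close> and \<open>v\<close> is off their line
  when \<open>d u v = 1\<close>, so the trace of the line on \<open>A\<close> is just
  \<open>{u, v}\<close>.\<close>

lemma near_clique_le_lines:
  assumes "A \<subseteq> X" and near: "\<And>x y. \<lbrakk>x \<in> A; y \<in> A\<rbrakk> \<Longrightarrow> \<not> far x y"
  shows "card A choose 2 \<le> card lines"
proof (rule pairs_le_lines)
  show "finite A" by (rule finite_subset[OF assms(1) finite_points])
next
  fix u v assume uv: "u \<in> A" "v \<in> A" "u \<noteq> v"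
  then have "line u v \<inter> A = {u, v}"
    using in_line_near[of u v] near assms(1) by blast
  then show "\<exists>L\<in>lines. L \<inter> A = {u, v}"
    using line_in_lines[of u v] uv assms(1) by blast
qed

section \<open>Pairs of points generating the same line\<close>

text \<open>Generating pairs are unordered sets: each counts once, and two of them share a point
  exactly when the sets meet.\<close>

definition far_gens :: "'a set \<Rightarrow> 'a set \<Rightarrow> 'a set set" where
  "far_gens Y L = {{u, v} | u v. u \<in> Y \<and> v \<in> Y \<and> far u v \<and> line u v = L}"

definition near_gens :: "'a set \<Rightarrow> 'a set \<Rightarrow> 'a set set" where
  "near_gens Y L = {{u, v} | u v. u \<in> Y \<and> v \<in> Y \<and> u \<noteq> v \<and> \<not> far u v \<and> line u v = L}"

lemma far_gens_pair:
  assumes "e \<in> far_gens Y L" "u \<in> e"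
  obtains v where "e = {u, v}" "far u v" "line u v = L"
proof -
  obtain a b where ab: "e = {a, b}" "far a b" "line a b = L"
    using assms(1) by (auto simp: far_gens_def)
  then consider "u = a" | "u = b" using assms(2) by blast
  then show thesis
    by cases (use ab that[of b] that[of a] far_sym[of a b] line_commute[of a b] in auto)
qed

lemma far_in_far_gens: "far u v \<Longrightarrow> {u, v} \<in> far_gens X (line u v)"
  unfolding far_gens_def using far_in[of u v] by (intro CollectI exI[of _ u] exI[of _ v]) simp

lemma near_gens_pair:
  assumes "e \<in> near_gens Y L" "u \<in> e"
  obtains v where "e = {u, v}" "u \<in> Y" "v \<in> Y" "u \<noteq> v" "\<not> far u v" "line u v = L"
proof -
  obtain a b where ab: "e = {a, b}" "a \<in> Y" "b \<in> Y" "a \<noteq> b" "\<not> far a b" "line a b = L"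
    using assms(1) by (auto simp: near_gens_def)
  then consider "u = a" | "u = b" using assms(2) by blast
  then show thesis
    by cases (use ab that[of b] that[of a] far_sym[of b a] line_commute[of a b] in auto)
qed

lemma far_gens_disjoint:
  assumes "e \<in> far_gens Y L" "e' \<in> far_gens Y L" "e \<noteq> e'"
  shows "e \<inter> e' = {}"
proof (rule ccontr)
  assume "e \<inter> e' \<noteq> {}"
  then obtain u where u: "u \<in> e" "u \<in> e'" by blast
  obtain v where v: "e = {u, v}" "far u v" "line u v = L"
    using far_gens_pair[OF assms(1) u(1)] .
  obtain w where w: "e' = {u, w}" "far u w" "line u w = L"
    using far_gens_pair[OF assms(2) u(2)] .
  have "v = w" using far_lines_through_point v w by simp
  then show False using v w assms(3) by simp
qed

text \<open>Two near generators with a common point would have twins as their other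
  endpoints.\<close>

lemma near_gens_disjoint:
  assumes "Y \<subseteq> X" and "\<forall>u\<in>Y. \<forall>v\<in>Y. \<not> twin u v"
  shows "\<lbrakk>e \<in> near_gens Y L; e' \<in> near_gens Y L; e \<noteq> e'\<rbrakk> \<Longrightarrow> e \<inter> e' = {}"
proof (rule ccontr)
  assume e: "e \<in> near_gens Y L" "e' \<in> near_gens Y L" "e \<noteq> e'" "e \<inter> e' \<noteq> {}"
  then obtain u where u: "u \<in> e" "u \<in> e'" by blast
  obtain v where v: "e = {u, v}" "u \<in> Y" "v \<in> Y" "u \<noteq> v" "\<not> far u v" "line u v = L"
    using near_gens_pair[OF e(1) u(1)] .
  obtain w where w: "e' = {u, w}" "w \<in> Y" "u \<noteq> w" "\<not> far u w" "line u w = L"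
    using near_gens_pair[OF e(2) u(2)] .
  have "twin v w"
    by (rule near_lines_through_point[of u]) (use v w e(3) assms(1) in auto)
  then show False using assms(2) v w by blast
qed

lemma finite_gens:
  assumes "Y \<subseteq> X"
  shows "finite (far_gens Y L)" "finite (near_gens Y L)"
proof -
  have "far_gens Y L \<subseteq> Pow X" "near_gens Y L \<subseteq> Pow X"
    using assms by (auto simp: far_gens_def near_gens_def)
  then show "finite (far_gens Y L)" "finite (near_gens Y L)"
    using finite_points by (simp_all add: finite_subset)
qed

text \<open>The points of one far generator lie on \<open>L\<close>, hence are at distance 1 from
  both points of any other. One point from each generator therefore gives a set without far
  pairs.\<close>

lemma far_gens_le_lines:
  assumes "Y \<subseteq> X"
  shows "card (far_gens Y L) choose 2 \<le> card lines"
proof -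
  have "e \<inter> X \<noteq> {}" if "e \<in> far_gens Y L" for e
    using that assms by (auto simp: far_gens_def)
  then obtain f where f: "\<And>e. e \<in> far_gens Y L \<Longrightarrow> f e \<in> e \<inter> X" "inj_on f (far_gens Y L)"
    using disjoint_family_transversal[of "far_gens Y L" X] far_gens_disjoint by metis
  have "\<not> far (f e) (f e')" if e: "e \<in> far_gens Y L" and e': "e' \<in> far_gens Y L" for e e'
  proof (cases "e = e'")
    case False
    obtain u v where uv: "e = {u, v}" "far u v" "line u v = L"
      using e by (auto simp: far_gens_def)
    obtain a b where ab: "e' = {a, b}" "far a b" "line a b = L"
      using e' by (auto simp: far_gens_def)
    have "f e' \<in> L"
      using f(1)[OF e'] ab in_line_far[of a b] by auto
    moreover have "f e' \<noteq> u" "f e' \<noteq> v"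
      using f(1)[OF e'] far_gens_disjoint[OF e e' False] uv by auto
    ultimately have "\<not> far (f e') u \<and> \<not> far (f e') v"
      using uv in_line_far[of u v "f e'"] by blast
    then show ?thesis
      using f(1)[OF e] uv(1) far_sym[of "f e" "f e'"] by auto
  qed simp
  then have "card (f ` far_gens Y L) choose 2 \<le> card lines"
    using f(1) by (intro near_clique_le_lines) auto
  then show ?thesis by (simp add: card_image[OF f(2)])
qed

text \<open>For two disjoint near pairs generating \<open>L\<close>, each point of the one is at distance 2 from exactly
  one point of the other. A line through such a pair at distance 2 contains both pairs, and meets
  every other near pair generating \<open>L\<close> in at most one point.\<close>

lemma near_gens_le_lines:
  assumes "Y \<subseteq> X" and "\<forall>u\<in>Y. \<forall>v\<in>Y. \<not> twin u v"
  shows "card (near_gens Y L) choose 2 \<le> card lines"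
proof (rule pairs_le_lines)
  let ?F = "near_gens Y L"
  note disj = near_gens_disjoint[OF assms]
  show "finite ?F" by (rule finite_gens(2)[OF assms(1)])
  have sub: "e \<subseteq> X \<inter> L" if e: "e \<in> ?F" for e
  proof -
    obtain u v where "e = {u, v}" "u \<in> X" "v \<in> X" "u \<noteq> v" "\<not> far u v" "line u v = L"
      using e assms(1) by (auto simp: near_gens_def)
    then show ?thesis
      using in_line_near[of u v u] in_line_near[of u v v] far_sym[of v u] by auto
  qed
  \<comment> \<open>\<open>x\<close> lies on \<open>L\<close>, which \<open>f\<close> generates, and
    outside \<open>f\<close> by disjointness; \<open>in_line_near\<close> then makes it far from
    exactly one point of \<open>f\<close>.\<close>
  have split: "\<exists>y z. f = {y, z} \<and> far x y \<and> \<not> far x z \<and> \<not> far y z"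
    if x: "x \<in> e" and e: "e \<in> ?F" and f: "f \<in> ?F" and "e \<noteq> f" for x e f
  proof -
    obtain u v where uv: "f = {u, v}" "u \<in> X" "v \<in> X" "u \<noteq> v" "\<not> far u v" "line u v = L"
      using f assms(1) by (auto simp: near_gens_def)
    have "x \<noteq> u" "x \<noteq> v" using disj[OF e f \<open>e \<noteq> f\<close>] x uv by auto
    moreover have "x \<in> line u v" using sub[OF e] x uv by blast
    ultimately have "far x u \<noteq> far x v"
      using in_line_near uv by blast
    then show ?thesis
      using uv far_sym by (metis insert_commute)
  qed
  fix e e' assume e: "e \<in> ?F" and e': "e' \<in> ?F" and ne: "e \<noteq> e'"
  obtain x where x: "x \<in> e" using e by (auto simp: near_gens_def)
  obtain y y' where y: "e' = {y, y'}" "far x y" "\<not> far x y'" "\<not> far y y'"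
    using split[OF x e e' ne] by blast
  obtain x' where x': "e = {x, x'}" "\<not> far x x'"
    using near_gens_pair[OF e x] .
  \<comment> \<open>The only point of \<open>e\<close> far from \<open>y\<close> is
    \<open>x\<close>, so the other point \<open>x'\<close> is at distance 1 from
    \<open>y\<close>.\<close>
  obtain a b where "e = {a, b}" "far y a" "\<not> far y b"
    using split[of y e' e] e e' ne y(1) by blast
  then have yx': "\<not> far y x'"
    using x'(1) far_sym[OF y(2)] by (auto simp: doubleton_eq_iff)
  have inX: "e \<subseteq> X" "e' \<subseteq> X" using sub e e' by auto
  have sub2: "e \<subseteq> line x y" "e' \<subseteq> line x y"
    using in_line_far[OF y(2)] inX x' yx' y far_sym[of x' x] far_sym[of x' y] far_sym[of y' x] far_sym[of y' y]
    by auto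
  have "\<not> f \<subseteq> line x y" if f: "f \<in> ?F" "f \<noteq> e" "f \<noteq> e'" for f
  proof -
    obtain z z' where z: "f = {z, z'}" "far x z"
      using split[OF x e f(1)] f by blast
    have "z \<noteq> x" "z \<noteq> y"
      using disj[OF f(1) e] disj[OF f(1) e'] f z x y by auto
    then have "z \<notin> line x y"
      using in_line_far[OF y(2)] z far_sym by blast
    then show ?thesis using z by blast
  qed
  \<comment> \<open>The pair is recovered from a line as the set of near generators of
    \<open>L\<close> contained in that line.\<close>
  then have "{f \<in> ?F. f \<subseteq> line x y} = {e, e'}"
    using sub2 e e' by blast
  then show "\<exists>M\<in>lines. {f \<in> ?F. f \<subseteq> M} = {e, e'}"
    using far_line_in_lines[OF y(2)] by (rule bexI)
qed

text \<open>Let \<open>p\<close>, \<open>q\<close> be a near generator. A far generator avoiding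
  both would have \<open>p\<close> and \<open>q\<close> at distance 1 from each of its points, but a
  point of \<open>L\<close> other than \<open>p\<close> and \<open>q\<close> is far from exactly one
  of them. So the far generators, being disjoint, use up distinct elements of
  \<open>{p, q}\<close>.\<close>

lemma far_gens_le_two:
  assumes "near_gens Y L \<noteq> {}" "Y \<subseteq> X"
  shows "card (far_gens Y L) \<le> 2"
proof -
  obtain p q where pq: "p \<in> X" "q \<in> X" "p \<noteq> q" "\<not> far p q" "line p q = L"
    using assms by (auto simp: near_gens_def)
  have "e \<inter> {p, q} \<noteq> {}" if e: "e \<in> far_gens Y L" for e
  proof
    assume empty: "e \<inter> {p, q} = {}"
    obtain a b where ab: "e = {a, b}" "far a b" "line a b = L"
      using e by (auto simp: far_gens_def)
    have "p \<in> L" "q \<in> L" using in_line_near[of p q p] in_line_near[of p q q] pq far_sym[of q p] by auto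
    then have "\<not> far p a" "\<not> far q a"
      using in_line_far[OF ab(2)] ab empty by auto
    moreover have "a \<in> L" using in_line_far[OF ab(2)] ab far_in by blast
    ultimately show False
      using in_line_near[of p q a] pq ab empty far_sym by auto
  qed
  then obtain f where f: "\<And>e. e \<in> far_gens Y L \<Longrightarrow> f e \<in> e \<inter> {p, q}" "inj_on f (far_gens Y L)"
    using disjoint_family_transversal[of "far_gens Y L" "{p, q}"] far_gens_disjoint by metis
  have "card (f ` far_gens Y L) \<le> card {p, q}"
    using f(1) by (intro card_mono) auto
  then show ?thesis
    using f(2) pq by (simp add: card_image)
qed

text \<open>The 3 is 2 + 1: once a near generator exists, far ones add at most 2 to the bound
  \<open>1 + sqrt (2 * l)\<close> for near ones, \<open>l\<close> being the number of lines.\<close>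

lemma gens_bound:
  assumes "Y \<subseteq> X" and "\<forall>u\<in>Y. \<forall>v\<in>Y. \<not> twin u v"
  shows "real (card (far_gens Y L \<union> near_gens Y L)) \<le> 3 + sqrt (2 * real (card lines))"
proof -
  have far: "real (card (far_gens Y L)) \<le> 1 + sqrt (2 * real (card lines))"
    using far_gens_le_lines[OF assms(1)] by (rule choose_two_le_imp)
  have near: "real (card (near_gens Y L)) \<le> 1 + sqrt (2 * real (card lines))"
    using near_gens_le_lines[OF assms] by (rule choose_two_le_imp)
  show ?thesis
  proof (cases "near_gens Y L = {}")
    case True
    then show ?thesis using far by simp
  next
    case False
    have "card (far_gens Y L \<union> near_gens Y L) \<le> 2 + card (near_gens Y L)"
      using far_gens_le_two[OF False assms(1)] card_Un_le[of "far_gens Y L" "near_gens Y L"] by linarith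
    then have "real (card (far_gens Y L \<union> near_gens Y L)) \<le> 2 + real (card (near_gens Y L))"
      by (metis of_nat_add of_nat_le_iff of_nat_numeral)
    then show ?thesis using near by linarith
  qed
qed

text \<open>Every pair in \<open>Y\<close> is counted at the line that it generates.\<close>

lemma twin_free_bound:
  assumes "Y \<subseteq> X" and "\<forall>u\<in>Y. \<forall>v\<in>Y. \<not> twin u v"
  shows "real (card Y choose 2) \<le> real (card lines) * (3 + sqrt (2 * real (card lines)))"
proof -
  have finY: "finite Y" by (rule finite_subset[OF assms(1) finite_points])
  let ?g = "\<lambda>L. far_gens Y L \<union> near_gens Y L"
  have "{B. B \<subseteq> Y \<and> card B = 2} \<subseteq> (\<Union>L\<in>lines. ?g L)"
  proof
    fix B assume "B \<in> {B. B \<subseteq> Y \<and> card B = 2}"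
    then obtain u v where B: "B = {u, v}" "u \<noteq> v" "u \<in> Y" "v \<in> Y"
      by (auto simp: card_2_iff)
    then have "B \<in> ?g (line u v)"
      by (auto simp: far_gens_def near_gens_def)
    moreover have "line u v \<in> lines" using B assms(1) line_in_lines by blast
    ultimately show "B \<in> (\<Union>L\<in>lines. ?g L)" by blast
  qed
  then have "card {B. B \<subseteq> Y \<and> card B = 2} \<le> card (\<Union>L\<in>lines. ?g L)"
    by (intro card_mono) (auto simp: finite_lines finite_gens[OF assms(1)])
  also have "\<dots> \<le> (\<Sum>L\<in>lines. card (?g L))"
    by (rule card_UN_le[OF finite_lines])
  finally have "real (card Y choose 2) \<le> (\<Sum>L\<in>lines. real (card (?g L)))"
    by (simp add: n_subsets[OF finY] flip: of_nat_sum)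
  also have "\<dots> \<le> real (card lines) * (3 + sqrt (2 * real (card lines)))"
    by (rule sum_bounded_above) (rule gens_bound[OF assms])
  finally show ?thesis .
qed

section \<open>Points that have a twin\<close>

text \<open>The twin \<open>w\<close> is far from \<open>u\<close>, hence off
  \<open>line u v\<close>. A disjoint far pair \<open>a\<close>, \<open>b\<close> with the same line
  would be near \<open>u\<close>, hence near its twin \<open>w\<close>, which would put
  \<open>w\<close> on \<open>line a b\<close>.\<close>

lemma far_line_unique:
  assumes uv: "far u v" and w: "twin u w" "w \<noteq> v" and ab: "far a b" "line a b = line u v"
  shows "{a, b} = {u, v}"
proof (cases "{a, b} \<inter> {u, v} = {}")
  case False
  have "{a, b} \<in> far_gens X (line u v)" "{u, v} \<in> far_gens X (line u v)"
    using far_in_far_gens[OF uv] far_in_far_gens[OF ab(1)] ab(2) by simp_all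
  then show ?thesis
    using False far_gens_disjoint by blast
next
  case True
  have "a \<in> line u v" "b \<in> line u v"
    using in_line_far[OF ab(1)] ab far_in by auto
  then have nf: "\<not> far a u" "\<not> far b u"
    using in_line_far[OF uv] True by auto
  have uw: "far u w" "w \<noteq> u" using w by (auto simp: twin_def)
  then have w_notin: "w \<notin> line u v"
    using in_line_far[OF uv] w far_sym by blast
  then have "a \<noteq> w" "b \<noteq> w"
    using \<open>a \<in> line u v\<close> \<open>b \<in> line u v\<close> by auto
  then have "\<not> far a w" "\<not> far b w"
    using nf w True by (auto simp: twin_def)
  then have "w \<in> line a b"
    using in_line_far[OF ab(1)] uw far_sym far_in by blast
  then show ?thesis using ab w_notin by simp
qed

text \<open>A far pair is good if one of its points has a twin other than the other point. By
  \<open>far_line_unique\<close> a line comes from at most one good pair, that is, from two ordered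
  ones; the pairs that are not good contribute at most \<open>card Z\<close>.\<close>

lemma far_pairs_bound:
  assumes Z: "Z \<subseteq> X" "\<forall>u\<in>Z. \<exists>w. twin u w"
  shows "card {(u, v) \<in> Z \<times> Z. far u v} \<le> 2 * card lines + card Z"
proof -
  have finZ: "finite Z" by (rule finite_subset[OF Z(1) finite_points])
  define good where "good = (\<lambda>u v. (\<exists>w. twin u w \<and> w \<noteq> v) \<or> (\<exists>w. twin v w \<and> w \<noteq> u))"
  define G where "G = {(u, v) \<in> Z \<times> Z. far u v \<and> good u v}"
  define B where "B = {(u, v) \<in> Z \<times> Z. far u v \<and> \<not> good u v}"
  have finG: "finite G" and finB: "finite B"
    unfolding G_def B_def by (rule finite_subset[of _ "Z \<times> Z"]; use finZ in auto)+
  \<comment> \<open>As \<open>u\<close> has a twin and no twin besides \<open>v\<close>, the second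
    component is determined by the first.\<close>
  have "v = v'" if B: "(u, v) \<in> B" "(u, v') \<in> B" for u v v'
  proof -
    obtain w where w: "twin u w" using B(1) Z(2) unfolding B_def by blast
    have "\<not> good u v" "\<not> good u v'" using B by (simp_all add: B_def)
    then show ?thesis using w unfolding good_def by blast
  qed
  then have "inj_on fst B" by (auto intro!: inj_onI)
  then have "card B = card (fst ` B)" by (simp add: card_image)
  also have "\<dots> \<le> card Z"
    by (rule card_mono[OF finZ]) (auto simp: B_def)
  finally have cB: "card B \<le> card Z" .
  define fib where "fib = (\<lambda>L. {(u, v) \<in> G. line u v = L})"
  have fib: "card (fib L) \<le> 2" for L
  proof (cases "fib L = {}")
    case False
    then obtain u v where "(u, v) \<in> fib L" by auto
    then have uv: "far u v" "good u v" "line u v = L"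
      by (auto simp: fib_def G_def)
    have "{a, b} = {u, v}" if "(a, b) \<in> fib L" for a b
    proof -
      have ab: "far a b" "line a b = L" using that by (auto simp: fib_def G_def)
      show ?thesis
        using uv(2) unfolding good_def
      proof (elim disjE exE conjE)
        fix w assume w: "twin u w" "w \<noteq> v"
        show ?thesis
          by (rule far_line_unique[OF uv(1) w ab(1)]) (simp only: ab(2) uv(3))
      next
        fix w assume w: "twin v w" "w \<noteq> u"
        have "{a, b} = {v, u}"
          by (rule far_line_unique[OF far_sym[OF uv(1)] w ab(1)])
            (simp only: ab(2) uv(3) line_commute[of v u])
        then show ?thesis by (simp add: insert_commute)
      qed
    qed
    then have "fib L \<subseteq> {(u, v), (v, u)}"
      by (auto simp: doubleton_eq_iff)
    then have "card (fib L) \<le> card {(u, v), (v, u)}"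
      by (intro card_mono) auto
    also have "\<dots> \<le> 2" by (intro card_insert_le_m1) simp_all
    finally show ?thesis .
  qed simp
  have "G \<subseteq> (\<Union>L\<in>lines. fib L)"
  proof
    fix x assume x: "x \<in> G"
    obtain u v where uv: "x = (u, v)" by (cases x)
    then have "far u v" using x by (simp add: G_def)
    then have "line u v \<in> lines" by (rule far_line_in_lines)
    moreover have "x \<in> fib (line u v)" using x uv by (simp add: fib_def)
    ultimately show "x \<in> (\<Union>L\<in>lines. fib L)" by blast
  qed
  moreover have "finite (fib L)" for L
    by (rule finite_subset[OF _ finG]) (auto simp: fib_def)
  ultimately have "card G \<le> card (\<Union>L\<in>lines. fib L)"
    by (intro card_mono) (simp_all add: finite_lines)
  also have "\<dots> \<le> (\<Sum>L\<in>lines. card (fib L))"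
    by (rule card_UN_le[OF finite_lines])
  also have "\<dots> \<le> card lines * 2"
    using sum_bounded_above[of lines "\<lambda>L. card (fib L)" 2] fib by simp
  finally have cG: "card G \<le> 2 * card lines" by simp
  have "{(u, v) \<in> Z \<times> Z. far u v} = G \<union> B"
    by (auto simp: G_def B_def)
  then show ?thesis
    using card_Un_le[of G B] cG cB by simp
qed

text \<open>Turan's bound for the relation \<open>far\<close>: its independent sets are bounded by
  \<open>near_clique_le_lines\<close>, its edges by \<open>far_pairs_bound\<close>.\<close>

lemma twins_bound:
  assumes Z: "Z \<subseteq> X" "\<forall>u\<in>Z. \<exists>w. twin u w"
  shows "(real (card Z))\<^sup>2
    \<le> (1 + sqrt (2 * real (card lines))) * (2 * real (card Z) + 2 * real (card lines))"
proof -
  have finZ: "finite Z" by (rule finite_subset[OF Z(1) finite_points])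
  let ?q = "1 + sqrt (2 * real (card lines))"
  have "(real (card Z))\<^sup>2 \<le> ?q * (real (card Z) + real (card {(u, v) \<in> Z \<times> Z. far u v}))"
  proof (rule independent_set_bound[OF finZ far_sym])
    fix A assume "A \<subseteq> Z" "\<And>x y. \<lbrakk>x \<in> A; y \<in> A\<rbrakk> \<Longrightarrow> \<not> far x y"
    then show "real (card A) \<le> ?q"
      using Z(1) by (intro choose_two_le_imp near_clique_le_lines) auto
  qed auto
  also have "\<dots> \<le> ?q * (2 * real (card Z) + 2 * real (card lines))"
  proof (rule mult_left_mono)
    have "real (card {(u, v) \<in> Z \<times> Z. far u v}) \<le> real (2 * card lines + card Z)"
      using far_pairs_bound[OF Z] by (simp only: of_nat_le_iff)
    then show "real (card Z) + real (card {(u, v) \<in> Z \<times> Z. far u v})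
        \<le> 2 * real (card Z) + 2 * real (card lines)"
      by simp
  qed (simp add: add_nonneg_nonneg)
  finally show ?thesis .
qed

section \<open>The lower bound from both cases\<close>

text \<open>The factor 8 fits both cases: \<open>n \<le> 2 * y\<close> gives n(n-2) \<le> 2y(2y-2),
  which is 8 times the number of pairs in \<open>Y\<close>, and \<open>n \<le> 2 * z\<close> gives
  n^2 \<le> 4z^2, where \<open>twins_bound\<close> supplies another factor 2.\<close>

lemma lines_lower_bound:
  "real (card X) * (real (card X) - 2)
    \<le> 8 * (3 + sqrt (2 * real (card lines))) * (real (card lines) + real (card X))"
proof -
  define n where "n = real (card X)"
  define l where "l = real (card lines)"
  define Z where "Z = {u \<in> X. \<exists>w. twin u w}"
  define Y where "Y = X - Z"
  define y where "y = real (card Y)"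
  define z where "z = real (card Z)"
  have ZX: "Z \<subseteq> X" and YX: "Y \<subseteq> X" by (auto simp: Z_def Y_def)
  have yz: "n = y + z"
    using card_Diff_subset[OF finite_subset[OF ZX finite_points] ZX] card_mono[OF finite_points ZX]
    by (simp add: n_def y_def z_def Y_def)
  have l0: "0 \<le> l" "0 \<le> y" "0 \<le> z" by (simp_all add: l_def y_def z_def)
  have s0: "0 \<le> sqrt (2 * l)" using l0 by simp
  have "n * (n - 2) \<le> 8 * ((3 + sqrt (2 * l)) * (l + n))"
  proof (cases "n \<le> 2 * y")
    case True
    have "\<forall>u\<in>Y. \<forall>v\<in>Y. \<not> twin u v"
      by (auto simp: Y_def Z_def)
    then have "real (card Y choose 2) \<le> l * (3 + sqrt (2 * l))"
      unfolding l_def by (rule twin_free_bound[OF YX])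
    then have Yb: "y * (y - 1) / 2 \<le> l * (3 + sqrt (2 * l))"
      by (simp add: real_choose_two y_def)
    have "0 \<le> (3 + sqrt (2 * l)) * n"
      using s0 l0 yz by simp
    then have rhs: "8 * (l * (3 + sqrt (2 * l))) \<le> 8 * ((3 + sqrt (2 * l)) * (l + n))"
      by (simp add: algebra_simps)
    show ?thesis
    \<comment> \<open>Multiplying the inequalities for \<open>n\<close> and \<open>n - 2\<close>
      requires \<open>n - 2\<close> to be nonnegative, so small \<open>n\<close> are treated
      apart.\<close>
    proof (cases "n \<le> 2")
      case True
      then have "n * (n - 2) \<le> 0" using l0 yz by (simp add: mult_nonneg_nonpos)
      moreover have "0 \<le> l * (3 + sqrt (2 * l))" using l0 s0 by simp
      ultimately show ?thesis using rhs by linarith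
    next
      case False
      then have "n * (n - 2) \<le> (2 * y) * (2 * y - 2)"
        using True l0 by (intro mult_mono) auto
      also have "\<dots> = 8 * (y * (y - 1) / 2)" by (simp add: algebra_simps)
      also have "\<dots> \<le> 8 * (l * (3 + sqrt (2 * l)))" using Yb by simp
      finally show ?thesis using rhs by linarith
    qed
  next
    case False
    then have "n \<le> 2 * z" using yz by linarith
    have zn: "z \<le> n" using yz l0 by simp
    have n0: "0 \<le> n" using yz l0 by simp
    have "z\<^sup>2 \<le> (1 + sqrt (2 * l)) * (2 * z + 2 * l)"
      unfolding z_def l_def using ZX by (rule twins_bound) (simp add: Z_def)
    also have "\<dots> \<le> (3 + sqrt (2 * l)) * (2 * n + 2 * l)"
      using zn l0 s0 by (intro mult_mono) auto
    finally have "4 * z\<^sup>2 \<le> 8 * ((3 + sqrt (2 * l)) * (l + n))"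
      by (simp add: algebra_simps)
    moreover have "n * (n - 2) \<le> n * n" using n0 by (simp add: algebra_simps)
    moreover have "n * n \<le> 4 * z\<^sup>2"
      using mult_mono[OF \<open>n \<le> 2 * z\<close> \<open>n \<le> 2 * z\<close>] n0 zn l0
      by (simp add: power2_eq_square)
    ultimately show ?thesis by linarith
  qed
  then show ?thesis unfolding n_def l_def by (simp only: mult.assoc)
qed

end

lemma min_lines_lower_bound:
  "real n * (real n - 2) \<le> 8 * (3 + sqrt (2 * real (min_lines n))) * (real (min_lines n) + real n)"
proof -
  obtain X :: "nat set" and d where X: "finite X" "card X = n" "one_two_metric_space X d"
    and lines: "card (metric_lines X d) = min_lines n"
    using min_lines_attained by blast
  interpret finite_one_two_space X d
    using X by unfold_locales
  show ?thesis using lines_lower_bound X lines by simp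
qed

section \<open>The upper bound by complete multipartite graphs\<close>

text \<open>The witness is the complete multipartite graph with parts of size \<open>s\<close>.\<close>

lemma min_lines_upper_bound:
  fixes s n :: nat
  assumes "s > 0"
  defines "m \<equiv> n div s + 1"
  shows "min_lines n \<le> m * (s choose 2) + (m choose 2)"
proof -
  define d :: "nat \<Rightarrow> nat \<Rightarrow> real"
    where "d = (\<lambda>i j. if i = j then 0 else if i div s = j div s then 2 else 1)"
  have sp: "one_two_metric_space {..<n} d"
    unfolding one_two_metric_space_def d_def
    by (auto intro!: Metric_space.intro split: if_splits)
  interpret finite_one_two_space "{..<n}" d
    using sp by unfold_locales auto
  have far: "far i j \<longleftrightarrow> i < n \<and> j < n \<and> i \<noteq> j \<and> i div s = j div s" for i j
    unfolding far_def by (auto simp: d_def)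
  \<comment> \<open>Two points of part \<open>k\<close> with residues \<open>B\<close> generate
    everything outside that part together with themselves: this is \<open>f (k, B)\<close>. Points
    of different parts generate the union of the two parts, given by \<open>g\<close>. The number
    \<open>m\<close> also allows for a last part that is incomplete or empty.\<close>
  define P where "P = {..<m} \<times> {B. B \<subseteq> {..<s} \<and> card B = 2}"
  define Q where "Q = {C. C \<subseteq> {..<m} \<and> card C = 2}"
  define f where "f = (\<lambda>(k, B). {i. i < n \<and> (i div s = k \<longrightarrow> i mod s \<in> B)})"
  define g where "g = (\<lambda>C. {i. i < n \<and> i div s \<in> C})"
  have "L \<in> f ` P \<union> g ` Q" if L: "L \<in> lines" for L
  proof -
    obtain u v where uv: "u < n" "v < n" "u \<noteq> v" "L = line u v"
      using L by (auto simp: metric_lines_def)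
    have div_lt: "u div s < m" "v div s < m"
      using uv by (simp_all add: m_def div_le_mono le_imp_less_Suc)
    show ?thesis
    proof (cases "u div s = v div s")
      case True
      have eqI: "i = j" if "i div s = j div s" "i mod s = j mod s" for i j
        using that by (metis div_mult_mod_eq)
      then have ne: "u mod s \<noteq> v mod s" using True uv by blast
      have "far u v" using uv True by (simp add: far)
      then have "p \<in> L \<longleftrightarrow> p \<in> f (u div s, {u mod s, v mod s})" for p
        using uv True eqI[of p u] eqI[of p v] by (auto simp: in_line_far far f_def)
      then have "L = f (u div s, {u mod s, v mod s})" by blast
      moreover have "(u div s, {u mod s, v mod s}) \<in> P"
        using ne div_lt assms(1) by (simp add: P_def)
      ultimately show ?thesis by blast
    next
      case False
      then have "\<not> far u v" by (simp add: far)
      then have "p \<in> L \<longleftrightarrow> p \<in> g {u div s, v div s}" for p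
        using uv False in_line_near[of u v p] by (auto simp: far g_def)
      then have "L = g {u div s, v div s}" by blast
      moreover have "{u div s, v div s} \<in> Q"
        using False div_lt by (simp add: Q_def)
      ultimately show ?thesis by blast
    qed
  qed
  then have "lines \<subseteq> f ` P \<union> g ` Q" by blast
  moreover have finP: "finite P" and finQ: "finite Q"
    by (simp_all add: P_def Q_def)
  ultimately have "card lines \<le> card (f ` P \<union> g ` Q)"
    by (intro card_mono) auto
  also have "\<dots> \<le> card P + card Q"
    using card_Un_le[of "f ` P" "g ` Q"] card_image_le[OF finP, of f] card_image_le[OF finQ, of g]
    by linarith
  also have "\<dots> = m * (s choose 2) + (m choose 2)"
    by (simp add: P_def Q_def card_cartesian_product n_subsets)
  finally show ?thesis
    using min_lines_le[OF finite_points one_two] by simp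
qed

text \<open>Parts of size s give about ns/2 + n^2/(2s^2) lines, which is least at s^3 = 2n; hence
  the choice of \<open>t\<close>, rounded up to an integer.\<close>

lemma min_lines_upper_bound_real:
  fixes n :: nat
  assumes "n \<ge> 1"
  defines "t \<equiv> (2 * real n) powr (1/3)"
  shows "real (min_lines n) \<le> (real n + t + 1) * t / 2 + (real n / t + 1) * (real n / t) / 2"
proof -
  have t0: "t > 0" using assms by simp
  define s where "s = nat \<lceil>t\<rceil>"
  have s: "t \<le> real s" "real s \<le> t + 1"
    using t0 by (simp_all add: s_def)
  have s0: "s > 0" using s(1) t0 by (cases s) auto
  define m where "m = n div s + 1"
  have "real (n div s) \<le> real n / real s" by (rule of_nat_div_le_of_nat)
  then have m1: "real m \<le> real n / real s + 1" by (simp add: m_def)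
  have "real n / real s \<le> real n / t"
    using s t0 by (intro divide_left_mono) auto
  then have m2: "real m \<le> real n / t + 1" using m1 by linarith
  have m_ge: "real m \<ge> 1" by (simp add: m_def)
  have "real m * real s \<le> real n + real s"
    using mult_right_mono[OF m1, of "real s"] s0 by (simp add: algebra_simps)
  then have A: "real m * real s * (real s - 1) \<le> (real n + t + 1) * t"
    using s s0 t0 by (intro mult_mono) auto
  have B: "real m * (real m - 1) \<le> (real n / t + 1) * (real n / t)"
    using m2 m_ge t0 by (intro mult_mono) auto
  have "real (min_lines n) \<le> real (m * (s choose 2) + (m choose 2))"
    using min_lines_upper_bound[OF s0, of n] unfolding m_def of_nat_le_iff .
  then have "real (min_lines n) \<le> real m * real s * (real s - 1) / 2 + real m * (real m - 1) / 2"
    by (simp add: real_choose_two)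
  also have "\<dots> \<le> (real n + t + 1) * t / 2 + (real n / t + 1) * (real n / t) / 2"
    by (intro add_mono divide_right_mono A B) simp_all
  finally show ?thesis .
qed

section \<open>Asymptotics\<close>

text \<open>With fewer than c n^(4/3) lines, the right side of \<open>min_lines_lower_bound\<close>
  is at most about 8 sqrt(2c) c n^2. The coefficient is below 1 exactly when c < 2^(-7/3), a
  contradiction for large n.\<close>

lemma eventually_min_lines_ge:
  assumes "0 < c" "c < 2 powr (-7/3)"
  shows "\<forall>\<^sub>F n in sequentially. c * real n powr (4/3) \<le> real (min_lines n)"
proof -
  have less: "(2 * c) powr (1/2) * c < 1 / 8"
  proof -
    have "(2 * c) powr (1/2) * c = sqrt 2 * c powr (3/2)"
      using assms(1) powr_add[of c "1/2" 1] by (simp add: real_sqrt_mult powr_half_sqrt)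
    also have "\<dots> < sqrt 2 * (2 powr (-7/3)) powr (3/2)"
      using assms by (intro mult_strict_left_mono powr_less_mono2) auto
    also have "\<dots> = 2 powr (1/2 + -7/2)"
      unfolding powr_add by (simp add: powr_powr powr_half_sqrt)
    also have "\<dots> = 2 powr (- 3)" by simp
    also have "\<dots> = 1 / 8"
      unfolding powr_minus by simp
    finally show ?thesis .
  qed
  have "(\<lambda>n. (3 + sqrt (2 * (c * real n powr (4/3)))) * (c * real n powr (4/3) + real n)
      / (real n * (real n - 2))) \<longlonglongrightarrow> (2 * c) powr (1/2) * c"
    using assms(1) by real_asymp
  from order_tendstoD(2)[OF this less]
  have "\<forall>\<^sub>F n in sequentially. (3 + sqrt (2 * (c * real n powr (4/3))))
      * (c * real n powr (4/3) + real n) / (real n * (real n - 2)) < 1 / 8" .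
  then show ?thesis
    using eventually_gt_at_top[of 2]
  proof eventually_elim
    case (elim n)
    define l where "l = real (min_lines n)"
    define b where "b = c * real n powr (4/3)"
    have pos: "real n * (real n - 2) > 0" using elim(2) by simp
    show ?case
    proof (rule ccontr)
      assume "\<not> c * real n powr (4/3) \<le> real (min_lines n)"
      then have "l \<le> b" by (simp add: l_def b_def)
      moreover have "0 \<le> l" by (simp add: l_def)
      ultimately have "(3 + sqrt (2 * l)) * (l + real n) \<le> (3 + sqrt (2 * b)) * (b + real n)"
        by (intro mult_mono add_mono real_sqrt_le_mono add_nonneg_nonneg) auto
      moreover have "real n * (real n - 2) \<le> 8 * ((3 + sqrt (2 * l)) * (l + real n))"
        using min_lines_lower_bound[of n] unfolding l_def by (simp only: mult.assoc)
      moreover have "8 * ((3 + sqrt (2 * b)) * (b + real n)) < real n * (real n - 2)"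
        using elim(1) pos by (simp add: b_def divide_less_eq)
      ultimately show False by linarith
    qed
  qed
qed

text \<open>At the optimal \<open>t\<close> the two summands have leading coefficients 2 * 2^(-5/3)
  and 2^(-5/3).\<close>

lemma eventually_min_lines_le:
  assumes "c > 3 * 2 powr (-5/3)"
  shows "\<forall>\<^sub>F n in sequentially. real (min_lines n) \<le> c * real n powr (4/3)"
proof -
  define t where "t = (\<lambda>n. (2 * real n) powr (1/3))"
  have "(\<lambda>n. ((real n + t n + 1) * t n / 2 + (real n / t n + 1) * (real n / t n) / 2)
      / real n powr (4/3)) \<longlonglongrightarrow> 2 powr (1/3) / 2 + inverse (2 powr (1/3)) * inverse (2 powr (1/3)) / 2"
    unfolding t_def by real_asymp
  moreover have "2 powr (1/3) / 2 + inverse (2 powr (1/3)) * inverse (2 powr (1/3)) / 2 = (3 * 2 powr (-5/3) :: real)"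
  proof -
    have "2 powr (1/3) / 2 = (2 powr (1/3 - 1) :: real)"
      unfolding powr_diff by simp
    also have "\<dots> = 2 powr (1 + -5/3)" by simp
    also have "\<dots> = 2 * 2 powr (-5/3)" unfolding powr_add by simp
    finally have 1: "2 powr (1/3) / 2 = (2 * 2 powr (-5/3) :: real)" .
    have "inverse (2 powr (1/3)) * inverse (2 powr (1/3)) / 2 = (2 powr (-1/3 + -1/3 - 1) :: real)"
      unfolding powr_diff powr_add by (simp add: powr_minus)
    also have "\<dots> = 2 powr (-5/3)" by simp
    finally show ?thesis using 1 by simp
  qed
  ultimately have "\<forall>\<^sub>F n in sequentially. ((real n + t n + 1) * t n / 2
      + (real n / t n + 1) * (real n / t n) / 2) / real n powr (4/3) < c"
    using assms by (simp add: order_tendstoD(2))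
  then show ?thesis
    using eventually_ge_at_top[of 1]
  proof eventually_elim
    case (elim n)
    then have "(real n + t n + 1) * t n / 2 + (real n / t n + 1) * (real n / t n) / 2
        < c * real n powr (4/3)"
      by (simp add: pos_divide_less_eq)
    then show ?case
      using min_lines_upper_bound_real[OF elim(2)] unfolding t_def by linarith
  qed
qed

theorem theorem3:
  "\<exists>\<epsilon> \<delta> :: nat \<Rightarrow> real. \<epsilon> \<in> o(\<lambda>_. 1) \<and> \<delta> \<in> o(\<lambda>_. 1) \<and>
     (\<forall>n\<ge>1. (1 + \<epsilon> n) * 2 powr (-7/3) * real n powr (4/3) \<le> real (min_lines n) \<and>
            real (min_lines n) \<le> (1 + \<delta> n) * (3 * 2 powr (-5/3)) * real n powr (4/3))"
proof -
  define \<alpha> \<beta> :: real where "\<alpha> = 2 powr (-7/3)" and "\<beta> = 3 * 2 powr (-5/3)"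
  have ab: "\<alpha> > 0" "\<beta> > 0" by (simp_all add: \<alpha>_def \<beta>_def)
  define r where "r = (\<lambda>n. real (min_lines n) / real n powr (4/3))"
  \<comment> \<open>The ratio \<open>r\<close> may stay away from both constants. Clipping at 0
    leaves only the one-sided estimates, which the two eventual bounds provide.\<close>
  define \<epsilon> where "\<epsilon> = (\<lambda>n. min 0 (r n / \<alpha> - 1))"
  define \<delta> where "\<delta> = (\<lambda>n. max 0 (r n / \<beta> - 1))"
  have "\<epsilon> \<longlonglongrightarrow> 0"
  proof (rule order_tendstoI)
    fix a :: real assume a: "a < 0"
    \<comment> \<open>Keeping \<open>a'\<close> above -1 makes the constant
      \<open>(1 + a') * \<alpha>\<close> positive, as \<open>eventually_min_lines_ge\<close>
      demands.\<close>
    define a' where "a' = max (a / 2) (- 1 / 2)"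
    have a': "a < a'" "a' < 0" "-1 < a'" using a by (auto simp: a'_def)
    have "\<forall>\<^sub>F n in sequentially. (1 + a') * \<alpha> * real n powr (4/3) \<le> real (min_lines n)"
      using a' ab by (intro eventually_min_lines_ge) (auto simp: \<alpha>_def)
    then show "\<forall>\<^sub>F n in sequentially. a < \<epsilon> n"
      using eventually_ge_at_top[of 1]
    proof eventually_elim
      case (elim n)
      then have "(1 + a') * \<alpha> \<le> r n"
        by (simp add: r_def pos_le_divide_eq)
      then have "1 + a' \<le> r n / \<alpha>" using ab by (simp add: pos_le_divide_eq)
      then show ?case using a a' by (simp add: \<epsilon>_def)
    qed
  qed (simp add: \<epsilon>_def min_less_iff_disj)
  moreover have "\<delta> \<longlonglongrightarrow> 0"
  proof (rule order_tendstoI)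
    fix a :: real assume a: "0 < a"
    have "\<forall>\<^sub>F n in sequentially. real (min_lines n) \<le> (1 + a / 2) * \<beta> * real n powr (4/3)"
      using a by (intro eventually_min_lines_le) (simp add: \<beta>_def)
    then show "\<forall>\<^sub>F n in sequentially. \<delta> n < a"
      using eventually_ge_at_top[of 1]
    proof eventually_elim
      case (elim n)
      then have "r n \<le> (1 + a / 2) * \<beta>"
        by (simp add: r_def pos_divide_le_eq)
      then have "r n / \<beta> \<le> 1 + a / 2" using ab by (simp add: pos_divide_le_eq)
      then show ?case using a by (simp add: \<delta>_def)
    qed
  qed (simp add: \<delta>_def less_max_iff_disj)
  moreover have "(1 + \<epsilon> n) * \<alpha> * real n powr (4/3) \<le> real (min_lines n)
      \<and> real (min_lines n) \<le> (1 + \<delta> n) * \<beta> * real n powr (4/3)" if "n \<ge> 1" for n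
  proof -
    have l: "real (min_lines n) = r n * real n powr (4/3)"
      using that by (simp add: r_def)
    have "1 + \<epsilon> n \<le> r n / \<alpha>" "r n / \<beta> \<le> 1 + \<delta> n"
      by (simp_all add: \<epsilon>_def \<delta>_def)
    then have "(1 + \<epsilon> n) * \<alpha> \<le> r n" "r n \<le> (1 + \<delta> n) * \<beta>"
      using ab by (simp_all add: pos_le_divide_eq pos_divide_le_eq)
    then show ?thesis
      unfolding l by (simp add: mult_right_mono)
  qed
  ultimately show ?thesis
    unfolding \<alpha>_def \<beta>_def
    by (intro exI[of _ \<epsilon>] exI[of _ \<delta>]) (auto intro!: smalloI_tendsto)
qed

end
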